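(* Let $H$ be a fixed finite simple connected graph with $|V(H)|=r\ge 3$, let $c\ge 2$ be a fixed integer, and let $\{G_n\}_{n\ge1}$ be a sequence of deterministic finite simple undirected graphs with $N(H,G_n)\ge1$ for all $n$. If $Z(H,G_n)$ converges in distribution to $\mathcal N(0,1)$ as $n\to\infty$, then $\mathbb E[Z(H,G_n)^4]\to 3$ as $n\to\infty$.
   Context: $G_n$ has vertex set $V(G_n)=\{1,\dots,v(G_n)\}$, edge set $E(G_n)$, and adjacency matrix $(a_{ij})$, $a_{ij}=\mathbf 1\{(i,j)\in E(G_n)\}$. Each vertex $v\in V(G_n)$ receives a color $X_v$, where the $X_v$ are independent and uniform on $\{1,\dots,c\}$. For $k\ge1$, $V(G_n)_k$ is the set of $k$-tuples $\mathbf s=(s_1,\dots,s_k)$ of distinct vertices of $G_n$. Identify $V(H)=\{1,\dots,r\}$ and let $\operatorname{Aut}(H)$ be the automorphism group of $H$. The number of copies of $H$ in $G_n$ is $N(H,G_n)=\frac1{|\operatorname{Aut}(H)|}\sum_{\mathbf s\in V(G_n)_r}\prod_{(i,j)\in E(H)}a_{s_is_j}$. The number of monochromatic copies of $H$ in $G_n$ is $$T(H,G_n)=\frac1{|\operatorname{Aut}(H)|}\sum_{\mathbf s\in V(G_n)_r}\mathbf 1\{X_{s_1}=\cdots=X_{s_r}\}\prod_{(i,j)\in E(H)}a_{s_is_j},$$ and $Z(H,G_n)=\dfrac{T(H,G_n)-\mathbb E[T(H,G_n)]}{\sigma_H(G_n)}$ with $\sigma_H(G_n)=\sqrt{\operatorname{Var}[T(H,G_n)]}$.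 *)

theory Defs
  imports "HOL-Probability.Probability" "Graph_Theory.Digraph_Component"
begin

text \<open>
  A finite simple undirected graph is a \<^term>\<open>pair_graph\<close>: a finite loop-free symmetric
  digraph without parallel arcs.  The arc set \<^term>\<open>parcs G\<close> contains an undirected edge
  in both orientations, so a product over \<^term>\<open>parcs H\<close> visits every edge of H twice;
  as adjacency entries of an undirected graph are symmetric and 0 or 1, the product over
  undirected edges has the same value.
\<close>

definition adj :: "nat pair_pre_digraph \<Rightarrow> nat \<Rightarrow> nat \<Rightarrow> real" where
  "adj G i j = of_bool ((i, j) \<in> parcs G)"

definition Aut :: "nat pair_pre_digraph \<Rightarrow> (nat \<Rightarrow> nat) set" where
  "Aut H = {p. p permutes pverts H \<and>
               (\<forall>i\<in>pverts H. \<forall>j\<in>pverts H. (p i, p j) \<in> parcs H \<longleftrightarrow> (i, j) \<in> parcs H)}"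

text \<open>k-tuples of distinct elements of V, as functions on {1..k}
  (with the value \<^term>\<open>undefined\<close> elsewhere).\<close>

definition distinct_tuples :: "nat \<Rightarrow> 'a set \<Rightarrow> (nat \<Rightarrow> 'a) set" where
  "distinct_tuples k V = {s \<in> {1..k} \<rightarrow>\<^sub>E V. inj_on s {1..k}}"

text \<open>In the following, H is a graph with vertex set {1..r}, where r = \<^term>\<open>card (pverts H)\<close>.\<close>

definition num_copies :: "nat pair_pre_digraph \<Rightarrow> nat pair_pre_digraph \<Rightarrow> real" where
  "num_copies H G =
     1 / real (card (Aut H)) *
     (\<Sum>s\<in>distinct_tuples (card (pverts H)) (pverts G). \<Prod>(i, j)\<in>parcs H. adj G (s i) (s j))"

definition mono_copies ::
    "nat pair_pre_digraph \<Rightarrow> nat pair_pre_digraph \<Rightarrow> (nat \<Rightarrow> 'w \<Rightarrow> nat) \<Rightarrow> 'w \<Rightarrow> real" where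
  "mono_copies H G X \<omega> =
     1 / real (card (Aut H)) *
     (\<Sum>s\<in>distinct_tuples (card (pverts H)) (pverts G).
        of_bool (\<forall>i\<in>{1..card (pverts H)}. \<forall>j\<in>{1..card (pverts H)}. X (s i) \<omega> = X (s j) \<omega>) *
        (\<Prod>(i, j)\<in>parcs H. adj G (s i) (s j)))"

definition std_mono_copies ::
    "'w measure \<Rightarrow> nat pair_pre_digraph \<Rightarrow> nat pair_pre_digraph \<Rightarrow> (nat \<Rightarrow> 'w \<Rightarrow> nat) \<Rightarrow> 'w \<Rightarrow> real" where
  "std_mono_copies M H G X \<omega> =
     (mono_copies H G X \<omega> - prob_space.expectation M (mono_copies H G X)) /
     sqrt (prob_space.variance M (mono_copies H G X))"

definition uniform_coloring ::
    "nat \<Rightarrow> 'w measure \<Rightarrow> nat pair_pre_digraph \<Rightarrow> (nat \<Rightarrow> 'w \<Rightarrow> nat) \<Rightarrow> bool" where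
  "uniform_coloring c M G X \<longleftrightarrow>
     prob_space.indep_vars M (\<lambda>_. count_space UNIV) X (pverts G) \<and>
     (\<forall>v\<in>pverts G. distr M (count_space UNIV) (X v) = measure_pmf (pmf_of_set {1..c}))"

end

theory Submission
  imports Defs
begin

text \<open>
  Convergence in distribution carries over to fourth moments as soon as the fourth powers are
  uniformly integrable, and a uniform bound on the eighth moments is enough for that.  So the
  theorem reduces to a bound \<open>E[Z\<^sup>8] \<le> K\<close> in which K depends on c and on the number r of
  vertices of H, but not on the graph that is coloured; the limit is then the fourth moment 3 of
  the standard normal law (\<open>weak_conv_m_imp_integral_conv\<close>).

  The bound is an instance of hypercontractivity.  The count of monochromatic copies is a sum of
  functions each of which looks at the colours of only r vertices; it is a function of
  ``degree'' at most r on the product space of all colourings.  On a product of uniform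
  c-point spaces a function f of degree at most d satisfies
  \<open>E[f\<^sup>4] \<le> (16 c\<^sup>2)\<^sup>d E[f\<^sup>2]\<^sup>2\<close>, whatever the number of factors (\<open>hypercontractive_4_2\<close>, a
  Bonami-type inequality proved by induction on the number of factors).  Since \<open>f\<^sup>2\<close> has degree at
  most 2d, the inequality can be used twice, for \<open>f\<^sup>2\<close> and for f, and this bounds \<open>E[f\<^sup>8]\<close> by a
  multiple of \<open>E[f\<^sup>2]\<^sup>4\<close> (\<open>mean_power8_le\<close>).  For the standardised count, \<open>E[Z\<^sup>2] \<le> 1\<close>.
\<close>

section \<open>Functions of low degree on a product space\<close>

definition depends_only :: "'i set \<Rightarrow> (('i \<Rightarrow> 'b) \<Rightarrow> real) \<Rightarrow> bool" where
  "depends_only S f \<longleftrightarrow> (\<forall>x y. (\<forall>i\<in>S. x i = y i) \<longrightarrow> f x = f y)"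

text \<open>
  For functions on a finite product this is the span of the functions of at most d coordinates,
  which is the usual space of functions of degree at most d.  Scalar factors need no rule of
  their own, because they can be absorbed into the summands g.
\<close>

inductive low_degree :: "nat \<Rightarrow> (('i \<Rightarrow> 'b) \<Rightarrow> real) \<Rightarrow> bool" for d where
  zero: "low_degree d (\<lambda>x. 0)"
| add_junta: "finite S \<Longrightarrow> card S \<le> d \<Longrightarrow> depends_only S g \<Longrightarrow> low_degree d f
    \<Longrightarrow> low_degree d (\<lambda>x. g x + f x)"

lemma low_degree_junta:
  assumes "finite S" "card S \<le> d" "depends_only S g"
  shows "low_degree d g"
  using low_degree.add_junta[OF assms low_degree.zero] by simp

lemma low_degree_const: "low_degree d (\<lambda>x. a)"
  by (rule low_degree_junta[of "{}"]) (auto simp: depends_only_def)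

lemma low_degree_add:
  assumes "low_degree d f" "low_degree d g"
  shows "low_degree d (\<lambda>x. f x + g x)"
  using assms(1)
proof induction
  case (add_junta S h f)
  show ?case
    using low_degree.add_junta[OF add_junta.hyps(1-3) add_junta.IH] by (simp add: add.assoc)
qed (use assms in simp)

lemma low_degree_sum:
  assumes "\<And>j. j \<in> J \<Longrightarrow> low_degree d (f j)"
  shows "low_degree d (\<lambda>x. \<Sum>j\<in>J. f j x)"
  using assms by (induction J rule: infinite_finite_induct) (auto intro: low_degree_add low_degree_const)

lemma low_degree_mult:
  assumes "low_degree d f" "low_degree e g"
  shows "low_degree (d + e) (\<lambda>x. f x * g x)"
  using assms(1)
proof induction
  case zero
  show ?case by (simp add: low_degree.zero)
next
  case (add_junta S h f)
  note S = add_junta.hyps(1-3)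
  have "low_degree (d + e) (\<lambda>x. h x * g x)"
    using assms(2)
  proof induction
    case zero
    show ?case by (simp add: low_degree.zero)
  next
    case (add_junta R k g)
    have "low_degree (d + e) (\<lambda>x. h x * k x)"
    proof (rule low_degree_junta[of "S \<union> R"])
      show "card (S \<union> R) \<le> d + e"
        using card_Un_le[of S R] S(2) add_junta.hyps(2) by linarith
      show "depends_only (S \<union> R) (\<lambda>x. h x * k x)"
        using S(3) add_junta.hyps(3) unfolding depends_only_def by (metis UnCI)
    qed (use S add_junta in auto)
    from low_degree_add[OF this add_junta.IH] show ?case
      by (simp add: distrib_left)
  qed
  from low_degree_add[OF this add_junta.IH] show ?case
    by (simp add: distrib_right)
qed

lemma low_degree_cmult:
  assumes "low_degree d f"
  shows "low_degree d (\<lambda>x. a * f x)"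
  using low_degree_mult[OF low_degree_const[of 0 a] assms] by simp

lemma low_degree_fix_coordinate:
  assumes "low_degree d f"
  shows "low_degree d (\<lambda>x. f (x(v := t)))"
  using assms
proof induction
  case (add_junta S g f)
  have "low_degree d (\<lambda>x. g (x(v := t)))"
    by (rule low_degree_junta[OF add_junta.hyps(1,2)])
       (use add_junta.hyps(3) in \<open>auto simp: depends_only_def\<close>)
  then show ?case using add_junta.IH by (rule low_degree_add)
qed (rule low_degree.zero)

text \<open>
  Differencing in one coordinate lowers the degree: a summand that ignores the coordinate v
  cancels, and one that uses v loses it from its set of coordinates once v is fixed to t or s.
\<close>

lemma low_degree_difference:
  assumes "low_degree (Suc d) f"
  shows "low_degree d (\<lambda>x. f (x(v := t)) - f (x(v := s)))"
  using assms
proof induction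
  case zero
  show ?case by (simp add: low_degree.zero)
next
  case (add_junta S g f)
  have "low_degree d (\<lambda>x. g (x(v := t)) - g (x(v := s)))"
  proof (cases "v \<in> S")
    case True
    show ?thesis
    proof (rule low_degree_junta[of "S - {v}"])
      show "card (S - {v}) \<le> d" using True add_junta.hyps(1,2) by simp
      have "g (x(v := a)) = g (y(v := a))" if "\<forall>i\<in>S - {v}. x i = y i" for x y a
        using add_junta.hyps(3) that unfolding depends_only_def by auto
      then show "depends_only (S - {v}) (\<lambda>x. g (x(v := t)) - g (x(v := s)))"
        unfolding depends_only_def by metis
    qed (use add_junta in auto)
  next
    case False
    then have "g (x(v := t)) = g (x(v := s))" for x
      using add_junta.hyps(3) unfolding depends_only_def
      by (metis fun_upd_other)
    then show ?thesis by (simp add: low_degree.zero)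
  qed
  from low_degree_add[OF this add_junta.IH] show ?case
    by (simp only: add_diff_add)
qed

lemma low_degree_0D:
  assumes "low_degree 0 f"
  shows "f x = f y"
  using assms by induction (auto simp: depends_only_def)

section \<open>Averages over a finite product\<close>

text \<open>
  The expectation under the uniform distribution on \<open>C\<^sup>V\<close>.  A colouring is an extensional
  function, so that the set of colourings is finite although the index type need not be.
\<close>

definition mean :: "'b set \<Rightarrow> 'i set \<Rightarrow> (('i \<Rightarrow> 'b) \<Rightarrow> real) \<Rightarrow> real" where
  "mean C V f = (\<Sum>x\<in>PiE V (\<lambda>_. C). f x) / real (card C) ^ card V"

lemma mean_empty [simp]: "mean C {} f = f (\<lambda>_. undefined)"
  by (simp add: mean_def)

lemma mean_add: "mean C V (\<lambda>x. f x + g x) = mean C V f + mean C V g"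
  by (simp add: mean_def sum.distrib add_divide_distrib)

lemma mean_cmult: "mean C V (\<lambda>x. a * f x) = a * mean C V f"
  by (simp add: mean_def sum_distrib_left)

lemma mean_sum: "mean C V (\<lambda>x. \<Sum>j\<in>J. f j x) = (\<Sum>j\<in>J. mean C V (f j))"
  unfolding mean_def by (subst sum.swap) (simp add: sum_divide_distrib)

lemma mean_mono: "(\<And>x. f x \<le> g x) \<Longrightarrow> mean C V f \<le> mean C V g"
  by (simp add: mean_def divide_right_mono sum_mono)

lemma mean_nonneg: "(\<And>x. 0 \<le> f x) \<Longrightarrow> 0 \<le> mean C V f"
  by (simp add: mean_def sum_nonneg)

lemma mean_const:
  assumes "finite V" "finite C" "C \<noteq> {}"
  shows "mean C V (\<lambda>x. a) = a"
  using assms by (simp add: mean_def card_PiE)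

lemma mean_Cauchy_Schwarz:
  "(mean C V (\<lambda>x. f x * g x))\<^sup>2 \<le> mean C V (\<lambda>x. (f x)\<^sup>2) * mean C V (\<lambda>x. (g x)\<^sup>2)"
proof -
  let ?N = "real (card C) ^ card V" and ?P = "PiE V (\<lambda>_. C)"
  have "(\<Sum>x\<in>?P. f x * g x)\<^sup>2 / ?N\<^sup>2 \<le> (\<Sum>x\<in>?P. (f x)\<^sup>2) * (\<Sum>x\<in>?P. (g x)\<^sup>2) / ?N\<^sup>2"
    by (intro divide_right_mono Cauchy_Schwarz_ineq_sum) auto
  then show ?thesis
    by (simp add: mean_def power_divide power2_eq_square[of ?N])
qed

text \<open>
  Fubini for one factor split off; this is what makes induction on the index set possible.
\<close>

lemma mean_insert:
  assumes "finite V" "v \<notin> V"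
  shows "mean C (insert v V) f = mean C V (\<lambda>x. (\<Sum>t\<in>C. f (x(v := t))) / real (card C))"
proof -
  have "(\<Sum>x\<in>PiE (insert v V) (\<lambda>_. C). f x)
      = (\<Sum>(t, x)\<in>C \<times> PiE V (\<lambda>_. C). f (x(v := t)))"
    unfolding PiE_insert_eq
    by (subst sum.reindex) (use inj_combinator[OF assms(2), of "\<lambda>_. C"] in \<open>auto simp: case_prod_unfold o_def\<close>)
  also have "\<dots> = (\<Sum>x\<in>PiE V (\<lambda>_. C). \<Sum>t\<in>C. f (x(v := t)))"
    by (subst sum.swap) (simp add: sum.cartesian_product)
  finally show ?thesis
    using assms by (simp add: mean_def sum_divide_distrib)
qed

section \<open>Hypercontractivity\<close>

text \<open>
  The term \<open>4 a\<^sup>3 b\<close> is kept exact because it averages to 0 in the application, whereas the cubic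
  term in b is absorbed by \<open>4 a b\<^sup>3 \<le> 2 a\<^sup>2 b\<^sup>2 + 2 b\<^sup>4\<close>.
\<close>

lemma fourth_power_add_le:
  fixes a b :: real
  shows "(a + b) ^ 4 \<le> a ^ 4 + 4 * a ^ 3 * b + 8 * (a\<^sup>2 * b\<^sup>2) + 3 * b ^ 4"
proof -
  have "a ^ 4 + 4 * a ^ 3 * b + 8 * (a\<^sup>2 * b\<^sup>2) + 3 * b ^ 4 - (a + b) ^ 4 = 2 * b\<^sup>2 * (a - b)\<^sup>2"
    by algebra
  moreover have "0 \<le> 2 * b\<^sup>2 * (a - b)\<^sup>2" by simp
  ultimately show ?thesis by linarith
qed

text \<open>
  Split off one coordinate v and write f as \<open>A + B\<close>, where A is the average of f over v and
  \<open>B t\<close> is the deviation from it when v has the value t.  The functions \<open>B t\<close> sum to 0 over t, and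
  they have degree one less than f because they are averages of differences of f in the
  coordinate v.  The induction hypothesis for A has one factor \<open>16 c\<^sup>2\<close> more than that for \<open>B t\<close>,
  and this gain pays for the constants 8 and 3 from \<open>fourth_power_add_le\<close> and for the loss of
  a factor c in bounding the average of \<open>E[(B t)\<^sup>2]\<^sup>2\<close> over t by the square of the average.
\<close>

lemma hypercontractive_4_2:
  fixes f :: "('i \<Rightarrow> 'b) \<Rightarrow> real"
  assumes C: "finite C" "C \<noteq> {}"
    and "finite V" "low_degree d f"
  shows "mean C V (\<lambda>x. f x ^ 4) \<le> (16 * real (card C) ^ 2) ^ d * (mean C V (\<lambda>x. (f x)\<^sup>2))\<^sup>2"
  using assms(3,4)
proof (induction V arbitrary: d f)
  case empty
  have "1 \<le> (16 * real (card C) ^ 2) ^ d"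
  proof (rule one_le_power)
    have "1 \<le> card C" using C by (simp add: Suc_le_eq card_gt_0_iff)
    then have "1 \<le> real (card C) ^ 2" by (intro one_le_power) simp
    then show "1 \<le> 16 * real (card C) ^ 2" by simp
  qed
  then have "1 * f (\<lambda>_. undefined) ^ 4 \<le> (16 * real (card C) ^ 2) ^ d * f (\<lambda>_. undefined) ^ 4"
    by (intro mult_right_mono) auto
  then show ?case by (simp add: power_mult[symmetric])
next
  case (insert v V)
  \<comment> \<open>The constant is written as a square \<open>k\<^sup>2\<close> so that the Cauchy-Schwarz step below needs no
    square roots.\<close>
  define c k where "c = real (card C)" and "k = 4 * c"
  have c1: "c \<ge> 1" using C by (simp add: c_def Suc_le_eq card_gt_0_iff)
  have K: "16 * c\<^sup>2 = k\<^sup>2" by (simp add: k_def power2_eq_square)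
  show ?case
  proof (cases d)
    case 0
    then obtain a where a: "f = (\<lambda>_. a)"
      using low_degree_0D insert.prems by blast
    show ?thesis using insert.hyps C by (simp add: 0 a mean_const)
  next
    case (Suc e)
    define A where "A = (\<lambda>x. (\<Sum>t\<in>C. f (x(v := t))) / c)"
    define B where "B = (\<lambda>t x. f (x(v := t)) - A x)"
    have split: "f (x(v := t)) = A x + B t x" for t x by (simp add: B_def)
    have sum_B: "(\<Sum>t\<in>C. B t x) = 0" for x
      using c1 by (simp add: B_def A_def sum_subtractf c_def)
    have f_deg: "low_degree (Suc e) f" using insert.prems Suc by simp
    have A_eq: "A = (\<lambda>x. (1 / c) * (\<Sum>t\<in>C. f (x(v := t))))" by (simp add: A_def)
    have A_deg: "low_degree (Suc e) A"
      unfolding A_eq by (intro low_degree_cmult low_degree_sum low_degree_fix_coordinate f_deg)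
    have B_eq: "B t = (\<lambda>x. (1 / c) * (\<Sum>s\<in>C. f (x(v := t)) - f (x(v := s))))" for t
      using c1 by (simp add: fun_eq_iff B_def A_def sum_subtractf c_def field_simps)
    have B_deg: "low_degree e (B t)" for t
      unfolding B_eq by (intro low_degree_cmult low_degree_sum low_degree_difference f_deg)
    define a b where "a = mean C V (\<lambda>x. (A x)\<^sup>2)" and "b = (\<lambda>t. mean C V (\<lambda>x. (B t x)\<^sup>2))"
    define K where "K = (k\<^sup>2) ^ e"
    have K0: "K \<ge> 0" by (simp add: K_def)
    have a0: "a \<ge> 0" by (simp add: a_def mean_nonneg)
    have b0: "b t \<ge> 0" for t by (simp add: b_def mean_nonneg)
    have A4: "mean C V (\<lambda>x. A x ^ 4) \<le> K * k\<^sup>2 * a\<^sup>2"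
      using insert.IH[OF A_deg] unfolding c_def[symmetric] \<open>16 * c\<^sup>2 = k\<^sup>2\<close> by (simp add: K_def a_def mult_ac)
    have B4: "mean C V (\<lambda>x. B t x ^ 4) \<le> K * (b t)\<^sup>2" for t
      using insert.IH[OF B_deg] unfolding c_def[symmetric] \<open>16 * c\<^sup>2 = k\<^sup>2\<close> by (simp add: K_def b_def)
    have AB: "mean C V (\<lambda>x. (A x)\<^sup>2 * (B t x)\<^sup>2) \<le> K * k * a * b t" for t
    proof (rule power2_le_imp_le)
      have "(mean C V (\<lambda>x. (A x)\<^sup>2 * (B t x)\<^sup>2))\<^sup>2
          \<le> mean C V (\<lambda>x. A x ^ 4) * mean C V (\<lambda>x. B t x ^ 4)"
        using mean_Cauchy_Schwarz[of C V "\<lambda>x. (A x)\<^sup>2" "\<lambda>x. (B t x)\<^sup>2"]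
        by (simp add: power_mult[symmetric])
      also have "\<dots> \<le> (K * k\<^sup>2 * a\<^sup>2) * (K * (b t)\<^sup>2)"
        using A4 B4 K0 by (intro mult_mono mean_nonneg) auto
      finally show "(mean C V (\<lambda>x. (A x)\<^sup>2 * (B t x)\<^sup>2))\<^sup>2 \<le> (K * k * a * b t)\<^sup>2"
        by (simp add: power_mult_distrib power2_eq_square mult_ac)
    qed (use K0 a0 b0 c1 in \<open>simp add: k_def\<close>)
    \<comment> \<open>By orthogonality of A and B, the second moment of f is \<open>a + s\<close>.\<close>
    define s where "s = (\<Sum>t\<in>C. b t) / c"
    have s0: "s \<ge> 0" using c1 b0 by (simp add: s_def sum_nonneg)
    have "(\<Sum>t\<in>C. (A x + B t x)\<^sup>2) / c = (A x)\<^sup>2 + (1 / c) * (\<Sum>t\<in>C. (B t x)\<^sup>2)" for x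
    proof -
      have "(\<Sum>t\<in>C. (A x + B t x)\<^sup>2) = c * (A x)\<^sup>2 + 2 * A x * (\<Sum>t\<in>C. B t x) + (\<Sum>t\<in>C. (B t x)\<^sup>2)"
        by (simp add: power2_sum sum.distrib sum_distrib_left c_def mult_ac)
      then show ?thesis using c1 sum_B by (simp add: field_simps)
    qed
    then have "mean C (insert v V) (\<lambda>x. (f x)\<^sup>2)
        = mean C V (\<lambda>x. (A x)\<^sup>2 + (1 / c) * (\<Sum>t\<in>C. (B t x)\<^sup>2))"
      using insert.hyps by (simp add: mean_insert split c_def[symmetric])
    also have "\<dots> = a + s"
      unfolding mean_add mean_cmult mean_sum by (simp add: a_def s_def b_def)
    finally have f2: "mean C (insert v V) (\<lambda>x. (f x)\<^sup>2) = a + s" .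
    have "(\<Sum>t\<in>C. (A x + B t x) ^ 4) / c
        \<le> A x ^ 4 + (8 / c) * (\<Sum>t\<in>C. (A x)\<^sup>2 * (B t x)\<^sup>2) + (3 / c) * (\<Sum>t\<in>C. B t x ^ 4)" for x
    proof -
      have "(\<Sum>t\<in>C. (A x + B t x) ^ 4)
          \<le> (\<Sum>t\<in>C. A x ^ 4 + 4 * A x ^ 3 * B t x + 8 * ((A x)\<^sup>2 * (B t x)\<^sup>2) + 3 * B t x ^ 4)"
        by (intro sum_mono fourth_power_add_le)
      also have "\<dots> = c * A x ^ 4 + 4 * A x ^ 3 * (\<Sum>t\<in>C. B t x)
          + 8 * (\<Sum>t\<in>C. (A x)\<^sup>2 * (B t x)\<^sup>2) + 3 * (\<Sum>t\<in>C. B t x ^ 4)"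
        by (simp add: sum.distrib sum_distrib_left c_def)
      finally show ?thesis using c1 sum_B by (simp add: field_simps)
    qed
    then have "mean C (insert v V) (\<lambda>x. f x ^ 4)
        \<le> mean C V (\<lambda>x. A x ^ 4 + (8 / c) * (\<Sum>t\<in>C. (A x)\<^sup>2 * (B t x)\<^sup>2) + (3 / c) * (\<Sum>t\<in>C. B t x ^ 4))"
      using insert.hyps by (simp add: mean_insert split c_def[symmetric] mean_mono)
    also have "\<dots> = mean C V (\<lambda>x. A x ^ 4) + (8 / c) * (\<Sum>t\<in>C. mean C V (\<lambda>x. (A x)\<^sup>2 * (B t x)\<^sup>2))
        + (3 / c) * (\<Sum>t\<in>C. mean C V (\<lambda>x. B t x ^ 4))"
      unfolding mean_add mean_cmult mean_sum ..
    also have "\<dots> \<le> K * k\<^sup>2 * a\<^sup>2 + (8 / c) * (\<Sum>t\<in>C. K * k * a * b t) + (3 / c) * (\<Sum>t\<in>C. K * (b t)\<^sup>2)"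
      using c1 by (intro add_mono mult_left_mono sum_mono A4 AB B4) auto
    also have "\<dots> = K * (k\<^sup>2 * a\<^sup>2 + 8 * k * a * s + 3 / c * (\<Sum>t\<in>C. (b t)\<^sup>2))"
      unfolding sum_distrib_left[symmetric] by (simp add: s_def algebra_simps)
    also have "\<dots> \<le> K * (k\<^sup>2 * a\<^sup>2 + 2 * k\<^sup>2 * a * s + k\<^sup>2 * s\<^sup>2)"
    proof (intro mult_left_mono add_mono K0 order_refl)
      have "8 * k \<le> 2 * k\<^sup>2" using c1 by (simp add: k_def power2_eq_square)
      then show "8 * k * a * s \<le> 2 * k\<^sup>2 * a * s" using a0 s0 by (intro mult_right_mono) auto
      have "(\<Sum>t\<in>C. (b t)\<^sup>2) \<le> (\<Sum>t\<in>C. b t)\<^sup>2"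
        using L2_set_le_sum[of C b] b0 by (simp add: L2_set_def sqrt_le_D)
      also have "\<dots> = c\<^sup>2 * s\<^sup>2" using c1 by (simp add: s_def power_divide)
      finally have "3 / c * (\<Sum>t\<in>C. (b t)\<^sup>2) \<le> 3 / c * (c\<^sup>2 * s\<^sup>2)"
        using c1 by (intro mult_left_mono) auto
      also have "\<dots> = 3 * c * s\<^sup>2" using c1 by (simp add: power2_eq_square)
      also have "\<dots> \<le> k\<^sup>2 * s\<^sup>2"
      proof (rule mult_right_mono)
        have "3 * c * 1 \<le> 16 * c * c" using c1 by (intro mult_mono) auto
        then show "3 * c \<le> k\<^sup>2" by (simp add: k_def power2_eq_square)
      qed simp
      finally show "3 / c * (\<Sum>t\<in>C. (b t)\<^sup>2) \<le> k\<^sup>2 * s\<^sup>2" .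
    qed simp
    also have "\<dots> = (k\<^sup>2) ^ d * (a + s)\<^sup>2"
      by (simp add: K_def Suc power2_sum algebra_simps)
    finally show ?thesis
      unfolding f2 c_def[symmetric] \<open>16 * c\<^sup>2 = k\<^sup>2\<close> .
  qed
qed

text \<open>
  The eighth moment of f is the fourth moment of \<open>f\<^sup>2\<close>, a function of degree at most 2d.
\<close>

lemma mean_power8_le:
  assumes C: "finite C" "C \<noteq> {}" and V: "finite V" and f: "low_degree d f"
  shows "mean C V (\<lambda>x. f x ^ 8) \<le> (16 * real (card C) ^ 2) ^ (4 * d) * (mean C V (\<lambda>x. (f x)\<^sup>2)) ^ 4"
proof -
  let ?K = "16 * real (card C) ^ 2"
  have "low_degree (2 * d) (\<lambda>x. (f x)\<^sup>2)"
    using low_degree_mult[OF f f] by (simp add: power2_eq_square mult_2)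
  from hypercontractive_4_2[OF C V this]
  have "mean C V (\<lambda>x. f x ^ 8) \<le> ?K ^ (2 * d) * (mean C V (\<lambda>x. f x ^ 4))\<^sup>2"
    by (simp add: power_mult[symmetric])
  also have "\<dots> \<le> ?K ^ (2 * d) * (?K ^ d * (mean C V (\<lambda>x. (f x)\<^sup>2))\<^sup>2)\<^sup>2"
    by (intro mult_left_mono power_mono hypercontractive_4_2[OF C V f] mean_nonneg) auto
  also have "\<dots> = (?K ^ (2 * d) * ?K ^ (d * 2)) * (mean C V (\<lambda>x. (f x)\<^sup>2)) ^ 4"
    by (simp only: power_mult_distrib power_mult[symmetric] mult.assoc) simp
  finally show ?thesis
    unfolding power_add[symmetric] by (simp add: mult.commute)
qed

section \<open>Weak convergence and unbounded test functions\<close>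

text \<open>
  Weak convergence gives the limit for the bounded function \<open>min f L\<close>.  The error made by
  truncating at L is at most \<open>\<integral> f\<^sup>2 / L\<close>, since \<open>f - min f L \<le> f\<^sup>2 / L\<close> pointwise, and this is
  small for large L uniformly along the sequence.
\<close>

lemma weak_conv_m_imp_integral_conv:
  fixes f :: "real \<Rightarrow> real"
  assumes \<mu>: "\<And>n. real_distribution (\<mu> n)" and \<nu>: "real_distribution \<nu>"
    and conv: "weak_conv_m \<mu> \<nu>"
    and cont: "\<And>x. isCont f x" and nonneg: "\<And>x. f x \<ge> 0"
    and int_\<mu>: "\<And>n. integrable (\<mu> n) (\<lambda>x. (f x)\<^sup>2)" and int_\<nu>: "integrable \<nu> (\<lambda>x. (f x)\<^sup>2)"
    and bound: "\<And>n. (\<integral>x. (f x)\<^sup>2 \<partial>\<mu> n) \<le> B"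
  shows "(\<lambda>n. \<integral>x. f x \<partial>\<mu> n) \<longlonglongrightarrow> (\<integral>x. f x \<partial>\<nu>)"
proof -
  define B' where "B' = max B (\<integral>x. (f x)\<^sup>2 \<partial>\<nu>)"
  have f_meas [measurable]: "f \<in> borel_measurable borel"
    using cont by (intro borel_measurable_continuous_onI continuous_at_imp_continuous_on) auto
  have trunc: "\<bar>(\<integral>x. f x \<partial>\<rho>) - (\<integral>x. min (f x) L \<partial>\<rho>)\<bar> \<le> B' / L"
    if \<rho>: "real_distribution \<rho>" "integrable \<rho> (\<lambda>x. (f x)\<^sup>2)" "(\<integral>x. (f x)\<^sup>2 \<partial>\<rho>) \<le> B'" and L: "L > 0"
    for \<rho> L
  proof -
    interpret real_distribution \<rho> by fact
    have i1: "integrable \<rho> f" 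
      by (rule square_integrable_imp_integrable) (use \<rho>(2) in auto)
    have i2: "integrable \<rho> (\<lambda>x. min (f x) L)"
      by (rule integrable_const_bound[of _ L]) (use nonneg L in \<open>auto simp: min_def\<close>)
    have pw: "f x - min (f x) L \<le> (f x)\<^sup>2 / L" for x
    proof (cases "f x \<le> L")
      case False
      then have "f x * L \<le> f x * f x" using nonneg by (intro mult_left_mono) auto
      then have "f x \<le> (f x)\<^sup>2 / L" using L by (simp add: pos_le_divide_eq power2_eq_square)
      then show ?thesis using False L by simp
    qed (use L in auto)
    have "(\<integral>x. f x - min (f x) L \<partial>\<rho>) \<le> (\<integral>x. (f x)\<^sup>2 / L \<partial>\<rho>)"
      by (intro integral_mono Bochner_Integration.integrable_diff i1 i2 pw) (use \<rho> in auto)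
    also have "\<dots> \<le> B' / L" using \<rho> L by (simp add: divide_right_mono)
    finally have "(\<integral>x. f x - min (f x) L \<partial>\<rho>) \<le> B' / L" .
    moreover have "0 \<le> (\<integral>x. f x - min (f x) L \<partial>\<rho>)" by (intro integral_nonneg_AE) auto
    ultimately show ?thesis using i1 i2 by simp
  qed
  show ?thesis
  proof (rule LIMSEQ_I)
    fix e :: real assume e: "e > 0"
    \<comment> \<open>Any level with \<open>B' / L < e / 3\<close> will do.\<close>
    define L where "L = 3 * \<bar>B'\<bar> / e + 1"
    have L: "L > 0" using e by (simp add: L_def add_nonneg_pos)
    have "3 * B' < e * L" using e by (simp add: L_def algebra_simps)
    then have BL: "B' / L < e / 3" using L by (simp add: field_simps)
    have "(\<lambda>n. \<integral>x. min (f x) L \<partial>\<mu> n) \<longlonglongrightarrow> (\<integral>x. min (f x) L \<partial>\<nu>)"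
      by (rule weak_conv_imp_integral_bdd_continuous_conv[OF \<mu> \<nu> conv, where B = L])
         (use L nonneg in \<open>auto intro!: continuous_min cont simp: abs_le_iff min_le_iff_disj order_trans[of _ 0]\<close>)
    from LIMSEQ_D[OF this, of "e / 3"] e obtain N where
      N: "\<And>n. n \<ge> N \<Longrightarrow> \<bar>(\<integral>x. min (f x) L \<partial>\<mu> n) - (\<integral>x. min (f x) L \<partial>\<nu>)\<bar> < e / 3"
      by auto
    have "norm ((\<integral>x. f x \<partial>\<mu> n) - (\<integral>x. f x \<partial>\<nu>)) < e" if "n \<ge> N" for n
    proof -
      have "(\<integral>x. (f x)\<^sup>2 \<partial>\<mu> n) \<le> B'" and "(\<integral>x. (f x)\<^sup>2 \<partial>\<nu>) \<le> B'"
        using bound[of n] by (simp_all add: B'_def)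
      from trunc[OF \<mu> int_\<mu> this(1) L] trunc[OF \<nu> int_\<nu> this(2) L] N[OF that] BL
      show ?thesis unfolding real_norm_def by linarith
    qed
    then show "\<exists>N. \<forall>n\<ge>N. norm ((\<integral>x. f x \<partial>\<mu> n) - (\<integral>x. f x \<partial>\<nu>)) < e" by blast
  qed
qed

section \<open>Moments of the standardised number of monochromatic copies\<close>

text \<open>
  The colours are only assumed to be measurable one vertex at a time; jointly they are measurable
  into the discrete space of colourings since a finite product of countable discrete spaces is
  discrete.  Hence h can be arbitrary.
\<close>

lemma uniform_coloring_measurable:
  fixes h :: "(nat \<Rightarrow> nat) \<Rightarrow> real"
  assumes "prob_space M" and V: "finite (pverts G)"
    and X: "uniform_coloring c M G X"
  shows "(\<lambda>\<omega>. h (\<lambda>v\<in>pverts G. X v \<omega>)) \<in> borel_measurable M"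
proof -
  interpret prob_space M by fact
  have "X v \<in> measurable M (count_space UNIV)" if "v \<in> pverts G" for v
    using X that by (auto simp: uniform_coloring_def indep_vars_def)
  then have "(\<lambda>\<omega>. \<lambda>v\<in>pverts G. X v \<omega>) \<in> measurable M (PiM (pverts G) (\<lambda>_. count_space UNIV))"
    by (intro measurable_restrict)
  also have "PiM (pverts G) (\<lambda>_. count_space (UNIV :: nat set)) = count_space (PiE (pverts G) (\<lambda>_. UNIV))"
    using V by (intro count_space_PiM_finite) auto
  finally show ?thesis
    by (rule measurable_compose) auto
qed

text \<open>
  By independence every colouring has probability \<open>1 / c ^ card V\<close>, so that expectations of functions of the
  colouring are averages over the finite product \<open>{1..c}\<^sup>V\<close>.
\<close>

lemma uniform_coloring_has_integral:
  fixes h :: "(nat \<Rightarrow> nat) \<Rightarrow> real"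
  assumes "prob_space M" and V: "finite (pverts G)" "pverts G \<noteq> {}" and c: "c \<noteq> 0"
    and X: "uniform_coloring c M G X"
  shows "has_bochner_integral M (\<lambda>\<omega>. h (\<lambda>v\<in>pverts G. X v \<omega>)) (mean {1..c} (pverts G) h)"
proof -
  interpret prob_space M by fact
  let ?V = "pverts G" and ?C = "{1..c}"
  define E where "E x = (\<Inter>v\<in>?V. X v -` {x v} \<inter> space M)" for x
  have indep: "indep_vars (\<lambda>_. count_space UNIV) X ?V"
    and distr: "\<And>v. v \<in> ?V \<Longrightarrow> distr M (count_space UNIV) (X v) = measure_pmf (pmf_of_set ?C)"
    using X by (auto simp: uniform_coloring_def)
  have rv: "X v \<in> measurable M (count_space UNIV)" if "v \<in> ?V" for v
    using indep that by (auto simp: indep_vars_def)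
  have prob_X: "prob (X v -` {t} \<inter> space M) = 1 / c" if "v \<in> ?V" "t \<in> ?C" for v t
  proof -
    have "prob (X v -` {t} \<inter> space M) = measure (distr M (count_space UNIV) (X v)) {t}"
      using rv[OF that(1)] by (simp add: measure_distr)
    also have "\<dots> = 1 / c"
      using that c by (simp add: distr measure_pmf_single)
    finally show ?thesis .
  qed
  have E_sets: "E x \<in> sets M" for x
    unfolding E_def using V rv by (intro sets.finite_INT measurable_sets[OF rv]) auto
  have prob_E: "prob (E x) = (1 / c) ^ card ?V" if "x \<in> PiE ?V (\<lambda>_. ?C)" for x
  proof -
    have "prob (E x) = (\<Prod>v\<in>?V. prob (X v -` {x v} \<inter> space M))"
      unfolding E_def by (rule indep_varsD_finite[OF indep]) (use V in auto)
    also have "\<dots> = (\<Prod>v\<in>?V. 1 / c)"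
      using that by (intro prod.cong prob_X) (auto simp: PiE_mem)
    finally show ?thesis by simp
  qed
  have "has_bochner_integral M (\<lambda>\<omega>. \<Sum>x\<in>PiE ?V (\<lambda>_. ?C). indicator (E x) \<omega> * h x)
      (\<Sum>x\<in>PiE ?V (\<lambda>_. ?C). prob (E x) * h x)"
    using E_sets by (intro has_bochner_integral_sum has_bochner_integral_mult_left has_bochner_integral_real_indicator)
      (auto simp: emeasure_eq_measure)
  also have "(\<Sum>x\<in>PiE ?V (\<lambda>_. ?C). prob (E x) * h x) = mean ?C ?V h"
    by (simp add: prob_E mean_def sum_divide_distrib power_divide)
  finally have main: "has_bochner_integral M (\<lambda>\<omega>. \<Sum>x\<in>PiE ?V (\<lambda>_. ?C). indicator (E x) \<omega> * h x) (mean ?C ?V h)" .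
  \<comment> \<open>Outside a null set the colours lie in \<open>{1..c}\<close>, and there exactly one of the events \<open>E x\<close>
    occurs.\<close>
  have "AE \<omega> in M. X v \<omega> \<in> ?C" if "v \<in> ?V" for v
  proof -
    have "AE t in distr M (count_space UNIV) (X v). t \<in> ?C"
      unfolding distr[OF that] using c by (simp add: AE_measure_pmf_iff)
    then show ?thesis using rv[OF that] by (subst (asm) AE_distr_iff) auto
  qed
  then have "AE \<omega> in M. \<forall>v\<in>?V. X v \<omega> \<in> ?C"
    using V by (intro AE_finite_allI) auto
  then have AE: "AE \<omega> in M. (\<Sum>x\<in>PiE ?V (\<lambda>_. ?C). indicator (E x) \<omega> * h x) = h (\<lambda>v\<in>?V. X v \<omega>)"
    using AE_space
  proof eventually_elim
    case (elim \<omega>)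
    have "indicator (E x) \<omega> * h x = (if x = (\<lambda>v\<in>?V. X v \<omega>) then h x else 0)"
      if "x \<in> PiE ?V (\<lambda>_. ?C)" for x
    proof -
      have "\<omega> \<in> E x \<longleftrightarrow> x = (\<lambda>v\<in>?V. X v \<omega>)"
        using elim(2) that V(2) by (auto simp: E_def fun_eq_iff PiE_def extensional_def restrict_def)
      then show ?thesis by (auto simp: indicator_def)
    qed
    then have "(\<Sum>x\<in>PiE ?V (\<lambda>_. ?C). indicator (E x) \<omega> * h x)
        = (\<Sum>x\<in>PiE ?V (\<lambda>_. ?C). if x = (\<lambda>v\<in>?V. X v \<omega>) then h x else 0)"
      by (intro sum.cong) auto
    also have "\<dots> = h (\<lambda>v\<in>?V. X v \<omega>)"
      using elim(1) V by (subst sum.delta) (auto intro!: finite_PiE)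
    finally show ?case .
  qed
  show ?thesis
    using main has_bochner_integral_cong_AE[OF _ uniform_coloring_measurable[OF assms(1) V(1) X] AE]
      borel_measurable_has_bochner_integral[OF main] by blast
qed

text \<open>
  With the evaluation maps \<open>\<lambda>v x. x v\<close> as colours, \<^const>\<open>mono_copies\<close> becomes a function on the
  space of colourings.  The summand of a tuple s sees only the colours of the entries of s.
\<close>

lemma mono_copies_low_degree:
  "low_degree (card (pverts H)) (mono_copies H G (\<lambda>v x. x v))"
proof -
  let ?r = "card (pverts H)"
  let ?f = "\<lambda>s x. of_bool (\<forall>i\<in>{1..?r}. \<forall>j\<in>{1..?r}. x (s i) = x (s j)) *
        (\<Prod>(i, j)\<in>parcs H. adj G (s i) (s j))"
  have "low_degree ?r (?f s)" for s
  proof (rule low_degree_junta[of "s ` {1..?r}"])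
    show "card (s ` {1..?r}) \<le> ?r" using card_image_le[of "{1..?r}" s] by simp
    show "depends_only (s ` {1..?r}) (?f s)" unfolding depends_only_def by auto
  qed auto
  then have "low_degree ?r (\<lambda>x. 1 / real (card (Aut H)) * (\<Sum>s\<in>distinct_tuples ?r (pverts G). ?f s x))"
    by (intro low_degree_cmult low_degree_sum)
  then show ?thesis unfolding mono_copies_def[abs_def] .
qed

lemma mono_copies_restrict:
  "mono_copies H G X \<omega> = mono_copies H G (\<lambda>v x. x v) (\<lambda>v\<in>pverts G. X v \<omega>)"
  unfolding mono_copies_def
  by (intro arg_cong2[of _ _ _ _ "(*)"] sum.cong refl)
     (auto simp: distinct_tuples_def PiE_mem)

text \<open>
  If the variance is 0, then the standardised count is 0 because of division by 0, and \<open>E[Z\<^sup>2] \<le> 1\<close>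
  holds in that case too.
\<close>

lemma std_mono_copies_moments:
  assumes "prob_space M" and V: "finite (pverts G)" "pverts G \<noteq> {}" and c: "c \<noteq> 0"
    and X: "uniform_coloring c M G X"
  shows "std_mono_copies M H G X \<in> borel_measurable M"
    and "integrable M (\<lambda>\<omega>. std_mono_copies M H G X \<omega> ^ 8)"
    and "prob_space.expectation M (\<lambda>\<omega>. std_mono_copies M H G X \<omega> ^ 8)
      \<le> (16 * real c ^ 2) ^ (4 * card (pverts H))"
proof -
  interpret prob_space M by fact
  define m s where "m = expectation (mono_copies H G X)" and "s = sqrt (variance (mono_copies H G X))"
  define g where "g x = (mono_copies H G (\<lambda>v x. x v) x - m) / s" for x
  have Z: "std_mono_copies M H G X = (\<lambda>\<omega>. g (\<lambda>v\<in>pverts G. X v \<omega>))"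
    unfolding std_mono_copies_def[abs_def] g_def m_def s_def mono_copies_restrict[of H G X, symmetric] ..
  note I = uniform_coloring_has_integral[OF assms]
  show "std_mono_copies M H G X \<in> borel_measurable M"
    unfolding Z by (rule uniform_coloring_measurable[OF assms(1) V(1) X])
  show "integrable M (\<lambda>\<omega>. std_mono_copies M H G X \<omega> ^ 8)"
    unfolding Z using I[of "\<lambda>x. g x ^ 8"] by (rule integrable.intros)
  have g2: "mean {1..c} (pverts G) (\<lambda>x. (g x)\<^sup>2) \<le> 1"
  proof -
    have "mean {1..c} (pverts G) (\<lambda>x. (g x)\<^sup>2) = expectation (\<lambda>\<omega>. (std_mono_copies M H G X \<omega>)\<^sup>2)"
      unfolding Z using has_bochner_integral_integral_eq[OF I[of "\<lambda>x. (g x)\<^sup>2"]] by simp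
    also have "\<dots> = variance (mono_copies H G X) / s\<^sup>2"
      by (simp add: std_mono_copies_def power_divide s_def m_def)
    also have "\<dots> \<le> 1" by (simp add: s_def divide_le_eq_1)
    finally show ?thesis .
  qed
  have "low_degree (card (pverts H)) (\<lambda>x. 1 / s * (mono_copies H G (\<lambda>v x. x v) x + - m))"
    by (intro low_degree_cmult low_degree_add mono_copies_low_degree low_degree_const)
  then have g_deg: "low_degree (card (pverts H)) g"
    by (simp add: g_def[abs_def] diff_conv_add_uminus del: add_uminus_conv_diff)
  have "expectation (\<lambda>\<omega>. std_mono_copies M H G X \<omega> ^ 8) = mean {1..c} (pverts G) (\<lambda>x. g x ^ 8)"
    unfolding Z using has_bochner_integral_integral_eq[OF I[of "\<lambda>x. g x ^ 8"]] by simp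
  also have "\<dots> \<le> (16 * real c ^ 2) ^ (4 * card (pverts H)) * (mean {1..c} (pverts G) (\<lambda>x. (g x)\<^sup>2)) ^ 4"
    using mean_power8_le[of "{1..c}", OF _ _ V(1) g_deg] c by simp
  also have "\<dots> \<le> (16 * real c ^ 2) ^ (4 * card (pverts H)) * 1"
    using g2 by (intro mult_left_mono power_le_one mean_nonneg) auto
  finally show "expectation (\<lambda>\<omega>. std_mono_copies M H G X \<omega> ^ 8)
      \<le> (16 * real c ^ 2) ^ (4 * card (pverts H))" by simp
qed

section \<open>The fourth moment of an asymptotically normal count\<close>

theorem theorem1p7:
  fixes H :: "nat pair_pre_digraph"
    and G :: "nat \<Rightarrow> nat pair_pre_digraph"
    and r c :: nat
    and v :: "nat \<Rightarrow> nat"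
    and M :: "nat \<Rightarrow> 'w measure"
    and X :: "nat \<Rightarrow> nat \<Rightarrow> 'w \<Rightarrow> nat"
  assumes H_graph: "pair_graph H"
    and H_verts: "pverts H = {1..r}"
    and r_ge: "r \<ge> 3"
    and H_connected: "Digraph_Component.connected (with_proj H)"
    and c_ge: "c \<ge> 2"
    and G_graph: "\<And>n. pair_graph (G n)"
    and G_verts: "\<And>n. pverts (G n) = {1..v n}"
    and copies: "\<And>n. num_copies H (G n) \<ge> 1"
    and M_prob: "\<And>n. prob_space (M n)"
    and X_coloring: "\<And>n. uniform_coloring c (M n) (G n) (X n)"
    and Z_normal: "weak_conv_m (\<lambda>n. distr (M n) borel (std_mono_copies (M n) H (G n) (X n)))
                     std_normal_distribution"
  shows "(\<lambda>n. prob_space.expectation (M n) (\<lambda>\<omega>. std_mono_copies (M n) H (G n) (X n) \<omega> ^ 4))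
           \<longlonglongrightarrow> 3"
proof -
  let ?Z = "\<lambda>n. std_mono_copies (M n) H (G n) (X n)"
  let ?\<mu> = "\<lambda>n. distr (M n) borel (?Z n)"
  have fin: "finite (pverts (G n))" for n by (simp add: G_verts)
  \<comment> \<open>A graph that contains a copy of H has a vertex.\<close>
  have nonempty: "pverts (G n) \<noteq> {}" for n
  proof
    assume "pverts (G n) = {}"
    then have "distinct_tuples (card (pverts H)) (pverts (G n)) = {}"
      using r_ge by (auto simp: distinct_tuples_def PiE_def Pi_def H_verts)
    then show False using copies[of n] by (simp add: num_copies_def)
  qed
  have "c \<noteq> 0" using c_ge by simp
  note Z = std_mono_copies_moments[OF M_prob fin nonempty this X_coloring]
  have Z_meas: "?Z n \<in> borel_measurable (M n)" for n by (rule Z(1))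
  have sq: "(x ^ 4)\<^sup>2 = x ^ 8" for x :: real by (simp flip: power_mult)
  have "(\<lambda>n. \<integral>x. x ^ 4 \<partial>?\<mu> n) \<longlonglongrightarrow> (\<integral>x. x ^ 4 \<partial>std_normal_distribution)"
  proof (rule weak_conv_m_imp_integral_conv[OF _ real_dist_normal_dist Z_normal])
    show "real_distribution (?\<mu> n)" for n
      using prob_space.real_distribution_distr[OF M_prob Z_meas] by simp
    show "integrable (?\<mu> n) (\<lambda>x. (x ^ 4)\<^sup>2)" for n
      using Z(2) Z_meas by (simp add: sq integrable_distr_eq)
    show "(\<integral>x. (x ^ 4)\<^sup>2 \<partial>?\<mu> n) \<le> (16 * real c ^ 2) ^ (4 * card (pverts H))" for n
      using Z(3) Z_meas by (simp add: sq integral_distr)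
    show "integrable std_normal_distribution (\<lambda>x. (x ^ 4)\<^sup>2)"
      by (simp only: sq integrable_std_normal_distribution_moment)
  qed auto
  moreover have "(\<integral>x. x ^ 4 \<partial>std_normal_distribution) = 3"
    using std_normal_distribution_even_moments(1)[of 2] by (simp add: fact_numeral)
  ultimately show ?thesis
    using Z_meas by (simp add: integral_distr)
qed

end
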